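(* Let $\omega>0$ and let $t\in\mathbb{C}$ satisfy $\Re\big(t(1-e^{-t})\big)<0$. Then $$\widehat{G}_N(\omega,t)=\frac{1-e^{-t}}{i\omega-t(1-e^{-t})}.$$
   Context: Let $G_N(x,t)=(1-e^{-t})\,e^{x t(1-e^{-t})}$. Its Fourier transform with respect to $x$ (taken over the half-line) is $$\widehat{G}_N(\omega,t):=\int_0^{\infty}(1-e^{-t})\,e^{x t(1-e^{-t})}\,e^{-i\omega x}\,dx .$$ *)

theory Defs
  imports "HOL-Analysis.Analysis"
begin

definition G_N :: "real \<Rightarrow> complex \<Rightarrow> complex" where
  "G_N x t = (1 - exp (- t)) * exp (of_real x * t * (1 - exp (- t)))"

definition half_line_fourier_integrand :: "(real \<Rightarrow> complex) \<Rightarrow> real \<Rightarrow> real \<Rightarrow> complex" where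
  "half_line_fourier_integrand f \<omega> x = f x * exp (- (\<i> * of_real \<omega> * of_real x))"

(* The Bochner integral is 0 for a non-integrable integrand, so this value is meaningful only
   together with integrability of the integrand on the half-line. *)
definition half_line_fourier :: "(real \<Rightarrow> complex) \<Rightarrow> real \<Rightarrow> complex" where
  "half_line_fourier f \<omega> = (LINT x:{0..}|lborel. half_line_fourier_integrand f \<omega> x)"

definition G_N_hat :: "real \<Rightarrow> complex \<Rightarrow> complex" where
  "G_N_hat \<omega> t = half_line_fourier (\<lambda>x. G_N x t) \<omega>"

end

theory Submission
  imports Defs "HOL-Real_Asymp.Real_Asymp"
begin

text \<open>For fixed \<open>t\<close> the integrand is the constant \<open>1 - exp (- t)\<close>
  times \<open>exp (c * x)\<close> with \<open>c = t * (1 - exp (- t)) - \<i> * \<omega>\<close>.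
  Subtracting an imaginary number leaves the real part alone, so Re c < 0 and the exponential
  decays. \<open>complex_exp_half_line\<close> gives its absolute integrability and its integral
  -1/c: integrate over [0, b] with the antiderivative exp(c x)/c and let b tend to infinity.\<close>

lemma complex_exp_half_line:
  fixes c :: complex
  assumes c: "Re c < 0"
  shows "set_integrable lborel {0..} (\<lambda>x. exp (c * of_real x))"
    and "(LINT x:{0..}|lborel. exp (c * of_real x)) = - 1 / c"
proof -
  have norm_exp: "norm (exp (c * of_real x)) = exp (Re c * x)" for x :: real
    by (simp add: norm_exp_eq_Re)
  \<comment> \<open>The modulus of the integrand is a decaying real exponential. Its gauge
    integrability gives Lebesgue integrability because it is nonnegative; Borel measurability then
    allows passing from \<open>lebesgue\<close> to \<open>lborel\<close>.\<close>
  have "set_integrable lebesgue {0..} (\<lambda>x. exp (Re c * x))"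
    using integrable_on_exp_minus_to_infinity[of "- Re c" 0] c
    by (intro nonnegative_absolutely_integrable_1) auto
  then have dom: "set_integrable lborel {0..} (\<lambda>x. exp (Re c * x))"
    unfolding set_integrable_def by (subst (asm) integrable_completion) auto
  show int: "set_integrable lborel {0..} (\<lambda>x. exp (c * of_real x))"
    by (rule set_integrable_bound[OF dom]) (auto simp: norm_exp set_borel_measurable_def)
  have "(LINT x:{0..b}|lborel. exp (c * of_real x)) = exp (c * of_real b) / c - 1 / c"
    if "0 \<le> b" for b
  proof -
    have "(LINT x|lborel. indicator {0..b} x *\<^sub>R exp (c * of_real x))
        = exp (c * of_real b) / c - exp (c * of_real 0) / c"
    proof (rule integral_FTC_atLeastAtMost[OF that])
      fix x :: real
      \<comment> \<open>Differentiate over the complex numbers, where c \<noteq> 0 since Re c < 0,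
        then restrict to the real line.\<close>
      have "((\<lambda>z. exp (c * z) / c) has_field_derivative exp (c * of_real x)) (at (of_real x))"
        using c by (auto intro!: derivative_eq_intros)
      then show "((\<lambda>x. exp (c * of_real x) / c) has_vector_derivative exp (c * of_real x))
          (at x within {0..b})"
        by (rule has_vector_derivative_real_field)
    qed (intro continuous_intros)
    then show ?thesis
      by (simp add: set_lebesgue_integral_def)
  qed
  then have eq: "\<forall>\<^sub>F b in at_top. exp (c * of_real b) / c - 1 / c
      = (LINT x:{0..b}|lborel. exp (c * of_real x))"
    by (intro eventually_at_top_linorderI[of 0]) simp
  have "((\<lambda>b. exp (Re c * b)) \<longlongrightarrow> 0) at_top"
    using c by real_asymp
  then have "((\<lambda>b. exp (c * of_real b)) \<longlongrightarrow> 0) at_top"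
    by (subst tendsto_norm_zero_iff[symmetric]) (simp only: norm_exp)
  then have "((\<lambda>b. exp (c * of_real b) / c - 1 / c) \<longlongrightarrow> 0 / c - 1 / c) at_top"
    using c by (intro tendsto_intros) auto
  then have "((\<lambda>b. LINT x:{0..b}|lborel. exp (c * of_real x)) \<longlongrightarrow> - 1 / c) at_top"
    using Lim_transform_eventually[OF _ eq] by simp
  \<comment> \<open>Absolute integrability makes the truncated integrals converge to the half-line
    integral, so uniqueness of limits identifies it.\<close>
  moreover have "((\<lambda>b. LINT x:{0..b}|lborel. exp (c * of_real x))
      \<longlongrightarrow> (LINT x:{0..}|lborel. exp (c * of_real x))) at_top"
    by (rule tendsto_set_lebesgue_integral_at_top[OF _ int]) simp
  ultimately show "(LINT x:{0..}|lborel. exp (c * of_real x)) = - 1 / c"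
    by (intro tendsto_unique[OF trivial_limit_at_top_linorder])
qed

theorem theorem10:
  fixes \<omega> :: real and t :: complex
  assumes "\<omega> > 0"
    and "Re (t * (1 - exp (- t))) < 0"
  shows "set_integrable lborel {0..} (half_line_fourier_integrand (\<lambda>x. G_N x t) \<omega>)
    \<and> G_N_hat \<omega> t = (1 - exp (- t)) / (\<i> * of_real \<omega> - t * (1 - exp (- t)))"
proof -
  define c where "c = t * (1 - exp (- t)) - \<i> * of_real \<omega>"
  have c: "Re c < 0"
    using assms(2) by (simp add: c_def)
  have integrand: "half_line_fourier_integrand (\<lambda>x. G_N x t) \<omega>
      = (\<lambda>x. (1 - exp (- t)) * exp (c * of_real x))"
    by (simp add: fun_eq_iff half_line_fourier_integrand_def G_N_def c_def algebra_simps
        flip: exp_add)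
  \<comment> \<open>The denominator is -c, matching the value -1/c of the exponential
    integral.\<close>
  have "(1 - exp (- t)) / (\<i> * of_real \<omega> - t * (1 - exp (- t))) = (1 - exp (- t)) * (- 1 / c)"
    by (simp add: c_def minus_divide_right)
  then show ?thesis
    using complex_exp_half_line[OF c]
    by (simp add: integrand G_N_hat_def half_line_fourier_def)
qed

end
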